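(* For every complex polynomial $f$ of the indicated degree the following relations hold. Degree $3$: $\varphi_{3,1,0}+\varphi_{3,1,2}=0$. Degree $4$: $\varphi_{4,1,0}+2\varphi_{4,1,2}=0$; $\ \varphi_{4,1,0}+2\varphi_{4,1,3}=0$; $\ \varphi_{4,1,2}-\varphi_{4,1,3}=0$. Degree $5$: $5\varphi_{5,1,2}-6\varphi_{5,1,3}+\varphi_{5,1,4}=0$. Degree $6$: $\varphi_{6,1,2}-3\varphi_{6,1,4}+2\varphi_{6,1,5}=0$; $\ 2\varphi_{6,1,3}-5\varphi_{6,1,4}+3\varphi_{6,1,5}=0$; $\ 3\varphi_{6,1,2}-4\varphi_{6,1,3}+\varphi_{6,1,4}=0$; $\ 5\varphi_{6,1,2}-6\varphi_{6,1,3}+\varphi_{6,1,5}=0$; $\ \varphi_{6,1,2}-2\varphi_{6,1,3}+2\varphi_{6,1,4}-\varphi_{6,1,5}=0$. (Any three of these five degree-$6$ relations are linearly dependent; any two are linearly independent, as coefficient vectors.)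
   Context: For a polynomial $f:\mathbb{C}\to\mathbb{C}$ of degree $D$ and $0\le\rho\le D-1$, let $\mathcal{R}^{(\rho)}$ be the multiset of the $D-\rho$ complex roots (counted with multiplicity) of the $\rho$-th derivative $f^{(\rho)}$ (with $f^{(0)}=f$). Define $\varphi_{D,\delta,\rho}=\frac{1}{D-\rho}\sum_{z\in\mathcal{R}^{(\rho)}} f^{(\delta)}(z)$, the mean value of $f^{(\delta)}$ over the roots of $f^{(\rho)}$. *)

theory Defs
  imports
    "HOL-Analysis.Analysis"
    "HOL-Computational_Algebra.Fundamental_Theorem_Algebra"
begin

(* Used with degree f = D and r < D.  By size_proots_complex the multiset then has D - r elements,
   so the quotient is the mean value; proots counts roots with multiplicity. *)
definition phi :: "nat \<Rightarrow> nat \<Rightarrow> nat \<Rightarrow> complex poly \<Rightarrow> complex" where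
  "phi D d r f =
     (\<Sum>z \<in># proots ((pderiv ^^ r) f). poly ((pderiv ^^ d) f) z) / of_nat (D - r)"

end

theory Submission
  imports Defs "HOL-Computational_Algebra.Polynomial_FPS"
begin

text \<open>
  Translating the variable changes none of the means \<open>phi D d r f\<close>
  (\<open>phi_pcompose_shift\<close>), so \<open>f\<close> may be taken depressed: of the form
  \<open>a\<^sub>D x\<^sup>D + a\<^bsub>D-2\<^esub> x\<^bsup>D-2\<^esup> + \<dots> + a\<^sub>0\<close>. The mean of \<open>f'\<close> over the roots of \<open>f\<^bsup>(r)\<^esup>\<close> is
  a linear combination of power sums of these roots, hence by Newton's identities a polynomial in the
  \<open>a\<^sub>i / a\<^sub>D\<close> times \<open>a\<^sub>D\<close>. Giving \<open>a\<^bsub>D-i\<^esub>\<close> the weight \<open>i\<close>, it is homogeneous of weight \<open>D - 1\<close>.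

  In low degree there are very few monomials of this weight without \<open>a\<^bsub>D-1\<^esub>\<close>: only \<open>a\<^sub>1\<close> for
  \<open>D = 3, 4\<close>; \<open>a\<^sub>1\<close> and \<open>a\<^sub>3\<^sup>2 / a\<^sub>5\<close> for \<open>D = 5\<close>; \<open>a\<^sub>1\<close> and \<open>a\<^sub>4 a\<^sub>3 / a\<^sub>6\<close> for \<open>D = 6\<close>. So
  all the means lie in a space of dimension one or two and must satisfy linear relations. The
  lemmas \<open>phi_cubic\<close>, \<open>phi_quartic\<close>, \<open>phi_quintic\<close> and \<open>phi_sextic\<close> give their coordinates in these
  monomials, from which each relation is read off. In degree 6 the four means with \<open>2 \<le> r \<le> 5\<close>
  span a plane, which leaves a plane of relations: this is why any three are dependent.

  Newton's identities come from logarithmic differentiation of \<open>\<Prod>(1 - z x)\<close>, the reflected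
  polynomial. Reflection also suits repeated differentiation: the \<open>i\<close>-th coefficient from the top of
  \<open>f\<^bsup>(r)\<^esup>\<close> is \<open>r! (D-i choose r) a\<^bsub>D-i\<^esub>\<close>, which is \<open>0\<close> by itself once \<open>i > D - r\<close>. Hence a
  single set of formulas for the power sums serves all \<open>r\<close>, including power sums of an order higher
  than the degree of \<open>f\<^bsup>(r)\<^esup>\<close>.
\<close>

section \<open>Power sums of roots and Newton's identities\<close>

definition power_sum :: "complex poly \<Rightarrow> nat \<Rightarrow> complex" where
  "power_sum p k = (\<Sum>z\<in>#proots p. z ^ k)"

lemma reflect_linear: "reflect_poly [:-w, 1:] = [:1, -w :: 'a::comm_ring_1:]"
  by (cases "w = 0") (simp_all add: reflect_poly_def)

text \<open>
  With \<open>E = \<Prod>(1 - x X)\<close> this is \<open>E' = - E \<Sum> x / (1 - x X)\<close>, the logarithmic derivative, with each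
  \<open>x / (1 - x X)\<close> expanded as a geometric series.
\<close>
lemma deriv_reflect_prod_linear_factors:
  fixes A :: "'a::idom multiset"
  shows "fps_deriv (fps_of_poly (reflect_poly (\<Prod>x\<in>#A. [:-x, 1:]))) =
    - (fps_of_poly (reflect_poly (\<Prod>x\<in>#A. [:-x, 1:])) * Abs_fps (\<lambda>k. \<Sum>x\<in>#A. x ^ Suc k))"
proof (induction A)
  case empty
  then show ?case by (simp add: fps_eq_iff)
next
  case (add w A)
  define E where "E = fps_of_poly (reflect_poly (\<Prod>x\<in>#A. [:-x, 1:]))"
  define S where "S = Abs_fps (\<lambda>k. \<Sum>x\<in>#A. x ^ Suc k)"
  define G where "G = Abs_fps (\<lambda>k. w ^ Suc k)"
  define L where "L = fps_of_poly [:1, -w:]"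
  have L: "L = 1 - fps_const w * fps_X"
    by (simp add: L_def fps_of_poly_pCons mult.commute)
  have geom: "L * G = fps_const w"
    by (simp add: fps_eq_iff G_def L algebra_simps power_eq_if)
  have E': "fps_of_poly (reflect_poly (\<Prod>x\<in>#add_mset w A. [:-x, 1:])) = L * E"
    by (simp add: reflect_poly_mult reflect_linear fps_of_poly_mult L_def E_def del: mult_pCons_left)
  have "fps_deriv (L * E) = - (L * G * E) - L * (E * S)"
    using add unfolding geom by (simp add: L E_def S_def algebra_simps)
  also have "\<dots> = - (L * E * (G + S))"
    by (simp add: algebra_simps)
  also have "G + S = Abs_fps (\<lambda>k. \<Sum>x\<in>#add_mset w A. x ^ Suc k)"
    by (simp add: fps_eq_iff G_def S_def)
  finally show ?case by (simp only: E')
qed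

text \<open>
  Both the identities for power sums up to the degree and the recurrence beyond it are covered, since
  the coefficients of the reflected polynomial vanish above the degree.
\<close>
lemma newton_identity:
  "of_nat (Suc k) * coeff (reflect_poly p) (Suc k) =
    - (\<Sum>i\<le>k. coeff (reflect_poly p) i * power_sum p (Suc k - i))"
proof -
  define q where "q = (\<Prod>x\<in>#proots p. [:-x, 1:])"
  have p: "p = smult (lead_coeff p) q"
    unfolding q_def by (rule complex_poly_decompose_multiset [symmetric])
  have q: "of_nat (Suc k) * coeff (reflect_poly q) (Suc k) =
      - (\<Sum>i\<le>k. coeff (reflect_poly q) i * power_sum p (Suc k - i))"
    using arg_cong [OF deriv_reflect_prod_linear_factors [of "proots p"], of "\<lambda>F. fps_nth F k"]
    by (simp add: fps_mult_nth power_sum_def q_def Suc_diff_le atLeast0AtMost)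
  have "coeff (reflect_poly p) i = lead_coeff p * coeff (reflect_poly q) i" for i
    by (subst p) (simp add: reflect_poly_smult)
  then show ?thesis using q
    by (simp add: sum_distrib_left mult.assoc mult.left_commute [of _ "lead_coeff p"] flip: sum_distrib_left)
qed

lemma depressed_power_sums:
  assumes "p \<noteq> 0" and "coeff (reflect_poly p) 1 = 0"
  defines "b \<equiv> \<lambda>i. coeff (reflect_poly p) i / lead_coeff p"
  shows "power_sum p 0 = of_nat (degree p)"
    and "power_sum p 1 = 0"
    and "power_sum p 2 = - 2 * b 2"
    and "power_sum p 3 = - 3 * b 3"
    and "power_sum p 4 = 2 * b 2 ^ 2 - 4 * b 4"
    and "power_sum p 5 = 5 * b 2 * b 3 - 5 * b 5"
proof -
  have b0: "b 0 = 1" using assms by simp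
  have b1: "b (Suc 0) = 0" using assms by simp
  have N: "of_nat (Suc k) * b (Suc k) = - (\<Sum>i\<le>k. b i * power_sum p (Suc k - i))" for k
    using newton_identity [of k p] assms(1)
    by (simp add: b_def field_simps flip: sum_divide_distrib)
  show "power_sum p 0 = of_nat (degree p)"
    by (simp add: power_sum_def size_proots_complex)
  show 1: "power_sum p 1 = 0"
    using N [of 0] by (simp add: b0 b1)
  show 2: "power_sum p 2 = - 2 * b 2"
    using N [of 1] 1 by (simp add: b0 b1 numeral_eq_Suc)
  show 3: "power_sum p 3 = - 3 * b 3"
    using N [of 2] 1 2 by (simp add: b0 b1 numeral_eq_Suc)
  show 4: "power_sum p 4 = 2 * b 2 ^ 2 - 4 * b 4"
    using N [of 3] 1 2 3 by (simp add: b0 b1 numeral_eq_Suc algebra_simps)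
  show "power_sum p 5 = 5 * b 2 * b 3 - 5 * b 5"
    using N [of 4] 1 2 3 4 by (simp add: b0 b1 numeral_eq_Suc algebra_simps)
qed

section \<open>Power sums of the roots of a higher derivative\<close>

lemma coeff_reflect_higher_pderiv:
  fixes f :: "complex poly"
  assumes "degree f = D" "r \<le> D" "i \<le> D"
  shows "coeff (reflect_poly ((pderiv ^^ r) f)) i =
    fact r * of_nat ((D - i) choose r) * coeff f (D - i)"
proof (cases "i \<le> D - r")
  case True
  \<comment> \<open>The pochhammer symbol in \<open>coeff_higher_pderiv\<close> is a falling factorial of \<open>D - i\<close>.\<close>
  then have [simp]: "D - (r + i) + r = D - i" "Suc (D - i) - r = Suc (D - r - i)"
    using assms by simp_all
  have "complex_of_nat ((D - i) choose r) = pochhammer (of_nat (D - i) - of_nat r + 1) r / fact r"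
    by (simp add: binomial_gbinomial gbinomial_pochhammer')
  also have "of_nat (D - i) - of_nat r + 1 = complex_of_nat (Suc (D - r - i))"
    using True assms by (simp add: of_nat_diff algebra_simps)
  finally show ?thesis using True assms(1)
    by (simp del: of_nat_Suc add: coeff_reflect_poly degree_higher_pderiv coeff_higher_pderiv)
next
  case False
  then show ?thesis using assms
    by (simp add: coeff_reflect_poly degree_higher_pderiv binomial_eq_0)
qed

text \<open>
  The factor \<open>r!\<close> cancels against the leading coefficient, so \<open>b i\<close> is the \<open>i\<close>-th coefficient from the
  top of the monic multiple of \<open>f\<^bsup>(r)\<^esup>\<close>. The bounds on \<open>D\<close> keep the subtraction \<open>D - i\<close> from being truncated.
\<close>
lemma depressed_derivative_power_sums:
  fixes f :: "complex poly"
  assumes deg: "degree f = D" and "r < D" "coeff f (D - 1) = 0"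
  defines "b \<equiv> \<lambda>i. of_nat ((D - i) choose r) * coeff f (D - i) / (of_nat (D choose r) * lead_coeff f)"
    and "s \<equiv> power_sum ((pderiv ^^ r) f)"
  shows "s 0 = of_nat (D - r)"
    and "s 1 = 0"
    and "2 \<le> D \<Longrightarrow> s 2 = - 2 * b 2"
    and "3 \<le> D \<Longrightarrow> s 3 = - 3 * b 3"
    and "4 \<le> D \<Longrightarrow> s 4 = 2 * b 2 ^ 2 - 4 * b 4"
    and "5 \<le> D \<Longrightarrow> s 5 = 5 * b 2 * b 3 - 5 * b 5"
proof -
  define g where "g = (pderiv ^^ r) f"
  have coeff: "coeff (reflect_poly g) i = fact r * of_nat ((D - i) choose r) * coeff f (D - i)" if "i \<le> D" for i
    unfolding g_def using assms that by (intro coeff_reflect_higher_pderiv) auto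
  have lead: "lead_coeff g = fact r * (of_nat (D choose r) * lead_coeff f)"
    using coeff [of 0] deg by simp
  have "g \<noteq> 0" using lead assms by auto
  have b: "coeff (reflect_poly g) i / lead_coeff g = b i" if "i \<le> D" for i
    using that unfolding lead by (simp add: coeff b_def)
  have sub: "coeff (reflect_poly g) 1 = 0"
    using assms by (simp add: coeff)
  note sums = depressed_power_sums [OF \<open>g \<noteq> 0\<close> sub]
  show "s 0 = of_nat (D - r)" "s 1 = 0"
    using sums(1,2) deg by (simp_all add: s_def g_def degree_higher_pderiv)
  show "2 \<le> D \<Longrightarrow> s 2 = - 2 * b 2" "3 \<le> D \<Longrightarrow> s 3 = - 3 * b 3"
    "4 \<le> D \<Longrightarrow> s 4 = 2 * b 2 ^ 2 - 4 * b 4" "5 \<le> D \<Longrightarrow> s 5 = 5 * b 2 * b 3 - 5 * b 5"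
    using sums(3-6) by (simp_all add: b s_def flip: g_def)
qed

section \<open>Means of the first derivative\<close>

lemma phi_first_derivative:
  assumes "degree f = D"
  shows "phi D 1 r f = (\<Sum>k<D. of_nat (Suc k) * coeff f (Suc k) * power_sum ((pderiv ^^ r) f) k) / of_nat (D - r)"
proof -
  have "poly (pderiv f) z = (\<Sum>k<D. of_nat (Suc k) * coeff f (Suc k) * z ^ k)" for z
  proof (cases D)
    case 0
    then obtain a where "f = [:a:]" using assms degree_eq_zeroE by blast
    then show ?thesis using 0 by simp
  next
    case (Suc n)
    then show ?thesis using assms
      by (simp add: poly_altdef degree_pderiv coeff_pderiv lessThan_Suc_atMost)
  qed
  moreover have "(\<Sum>z\<in>#A. \<Sum>k<D. c k * z ^ k) = (\<Sum>k<D. c k * (\<Sum>z\<in>#A. z ^ k))" for A and c :: "nat \<Rightarrow> complex"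
    by (induction A) (simp_all add: sum.distrib algebra_simps)
  ultimately show ?thesis by (simp add: phi_def power_sum_def)
qed

section \<open>Reduction to depressed polynomials\<close>

lemma higher_pderiv_pcompose_shift:
  fixes f :: "'a::{comm_ring_1,idom} poly"
  shows "(pderiv ^^ r) (pcompose f [:c, 1:]) = pcompose ((pderiv ^^ r) f) [:c, 1:]"
  by (induction r) (simp_all add: pderiv_pcompose pderiv_pCons)

lemma proots_pcompose_shift:
  fixes p :: "complex poly"
  shows "proots (pcompose p [:c, 1:]) = image_mset (\<lambda>z. z - c) (proots p)"
proof (cases "p = 0")
  case False
  have "pcompose (\<Prod>x\<in>#A. [:-x, 1:]) [:c, 1:] = (\<Prod>x\<in>#image_mset (\<lambda>z. z - c) A. [:-x, 1:])" for A
    by (induction A)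
      (simp_all add: pcompose_mult pcompose_1 pcompose_pCons algebra_simps del: mult_pCons_left)
  moreover have "proots (\<Prod>x\<in>#A. [:-x, 1:]) = A" for A :: "complex multiset"
  proof (induction A)
    case (add x A)
    have "(\<Prod>x\<in>#A. [:-x, 1:]) \<noteq> 0" by (simp add: prod_mset_zero_iff image_iff)
    with add show ?case by (simp add: proots_mult del: mult_pCons_left)
  qed simp
  ultimately show ?thesis
    using False complex_poly_decompose_multiset [of p]
    by (metis leading_coeff_0_iff pcompose_smult proots_smult)
qed simp

lemma phi_pcompose_shift: "phi D d r (pcompose f [:c, 1:]) = phi D d r f"
  by (simp add: phi_def higher_pderiv_pcompose_shift proots_pcompose_shift poly_pcompose
      image_mset.compositionality o_def)

text \<open>
  The centroid of the roots of \<open>f\<close> is the only root of the linear polynomial \<open>f\<^bsup>(n)\<^esup>\<close>; moving it to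
  the origin removes the subleading coefficient.
\<close>
lemma obtain_depressed_shift:
  fixes f :: "complex poly"
  assumes "degree f = Suc n"
  obtains h where "degree h = Suc n" "coeff h n = 0" "\<And>d r. phi (Suc n) d r h = phi (Suc n) d r f"
proof -
  have "degree ((pderiv ^^ n) f) = 1"
    using assms by (simp add: degree_higher_pderiv)
  then obtain c where c: "poly ((pderiv ^^ n) f) c = 0"
    using fundamental_theorem_of_algebra constant_degree by (metis zero_neq_one)
  define h where "h = pcompose f [:c, 1:]"
  have "coeff ((pderiv ^^ n) h) 0 = 0"
    using c by (simp add: h_def higher_pderiv_pcompose_shift poly_pcompose flip: poly_0_coeff_0)
  then have "coeff h n = 0"
    by (simp add: coeff_higher_pderiv pochhammer_fact [symmetric])
  moreover have "degree h = Suc n"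
    using assms by (simp add: h_def degree_pcompose)
  ultimately show thesis using that by (simp add: h_def phi_pcompose_shift)
qed

section \<open>The means in degrees three to six\<close>

lemma coeff_degree_nonzero: "degree f = D \<Longrightarrow> 0 < D \<Longrightarrow> coeff f D \<noteq> 0"
  by auto

lemma small_binomials:
  "3 choose 2 = (3::nat)" "4 choose 2 = (6::nat)" "4 choose 3 = (4::nat)"
  "5 choose 2 = (10::nat)" "5 choose 3 = (10::nat)" "5 choose 4 = (5::nat)"
  "6 choose 2 = (15::nat)" "6 choose 3 = (20::nat)" "6 choose 4 = (15::nat)" "6 choose 5 = (6::nat)"
  by (simp_all add: eval_nat_numeral)

lemma phi_cubic:
  assumes "degree f = 3" "coeff f 2 = 0"
  shows "phi 3 1 0 f = - coeff f 1" "phi 3 1 2 f = coeff f 1"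
proof -
  have "coeff f 3 \<noteq> 0" using coeff_degree_nonzero [OF assms(1)] by simp
  then show "phi 3 1 0 f = - coeff f 1" "phi 3 1 2 f = coeff f 1"
    using assms(1,2)
    by (simp_all add: phi_first_derivative [OF assms(1), unfolded One_nat_def]
        depressed_derivative_power_sums [OF assms(1), unfolded One_nat_def]
        depressed_derivative_power_sums [OF assms(1), of 0, unfolded One_nat_def funpow_0]
        small_binomials binomial_eq_0 lessThan_nat_numeral lessThan_Suc field_simps power2_eq_square)
qed

lemma phi_quartic:
  assumes "degree f = 4" "coeff f 3 = 0"
  shows "phi 4 1 0 f = - 2 * coeff f 1" "phi 4 1 2 f = coeff f 1" "phi 4 1 3 f = coeff f 1"
proof -
  have "coeff f 4 \<noteq> 0" using coeff_degree_nonzero [OF assms(1)] by simp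
  then show "phi 4 1 0 f = - 2 * coeff f 1" "phi 4 1 2 f = coeff f 1" "phi 4 1 3 f = coeff f 1"
    using assms(1,2)
    by (simp_all add: phi_first_derivative [OF assms(1), unfolded One_nat_def]
        depressed_derivative_power_sums [OF assms(1), unfolded One_nat_def]
        depressed_derivative_power_sums [OF assms(1), of 0, unfolded One_nat_def funpow_0]
        small_binomials binomial_eq_0 lessThan_nat_numeral lessThan_Suc field_simps power2_eq_square)
qed

text \<open>
  For \<open>r \<ge> 2\<close> the roots of \<open>f\<^bsup>(r)\<^esup>\<close> do not depend on the linear coefficient of \<open>f\<close>, so that coefficient
  enters the mean of \<open>f'\<close> only as the constant term of \<open>f'\<close>, with factor \<open>1\<close>.
\<close>
lemma phi_quintic:
  assumes "degree f = 5" "coeff f 4 = 0"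
  defines "w \<equiv> (coeff f 3)^2 / coeff f 5"
  shows "phi 5 1 2 f = coeff f 1 - 3/10 * w" "phi 5 1 3 f = coeff f 1 - 1/4 * w" "phi 5 1 4 f = coeff f 1"
proof -
  have "coeff f 5 \<noteq> 0" using coeff_degree_nonzero [OF assms(1)] by simp
  then show "phi 5 1 2 f = coeff f 1 - 3/10 * w" "phi 5 1 3 f = coeff f 1 - 1/4 * w" "phi 5 1 4 f = coeff f 1"
    using assms(1,2)
    by (simp_all add: w_def phi_first_derivative [OF assms(1), unfolded One_nat_def]
        depressed_derivative_power_sums [OF assms(1), unfolded One_nat_def]
        small_binomials binomial_eq_0 lessThan_nat_numeral lessThan_Suc field_simps power2_eq_square)
qed

lemma phi_sextic:
  assumes "degree f = 6" "coeff f 5 = 0"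
  defines "w \<equiv> coeff f 4 * coeff f 3 / coeff f 6"
  shows "phi 6 1 2 f = coeff f 1 - 3/5 * w" "phi 6 1 3 f = coeff f 1 - 1/2 * w"
    "phi 6 1 4 f = coeff f 1 - 1/5 * w" "phi 6 1 5 f = coeff f 1"
proof -
  have "coeff f 6 \<noteq> 0" using coeff_degree_nonzero [OF assms(1)] by simp
  then show "phi 6 1 2 f = coeff f 1 - 3/5 * w" "phi 6 1 3 f = coeff f 1 - 1/2 * w"
    "phi 6 1 4 f = coeff f 1 - 1/5 * w" "phi 6 1 5 f = coeff f 1"
    using assms(1,2)
    by (simp_all add: w_def phi_first_derivative [OF assms(1), unfolded One_nat_def]
        depressed_derivative_power_sums [OF assms(1), unfolded One_nat_def]
        small_binomials binomial_eq_0 lessThan_nat_numeral lessThan_Suc field_simps power2_eq_square)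
qed

section \<open>Rank of the relations in degree six\<close>

lemma vector_4:
 "(vector [x,y,z,w] ::('a::zero)^4)$1 = x"
 "(vector [x,y,z,w] ::('a::zero)^4)$2 = y"
 "(vector [x,y,z,w] ::('a::zero)^4)$3 = z"
 "(vector [x,y,z,w] ::('a::zero)^4)$4 = w"
  unfolding vector_def by simp_all

lemma independent_pair_of_minor:
  fixes u v :: "real ^ 'n"
  assumes minor: "u $ i * v $ j \<noteq> u $ j * v $ i"
  shows "u \<noteq> v" and "independent {u, v}"
proof -
  show "u \<noteq> v" using minor by (metis mult.commute)
  have "v \<noteq> 0" using minor by (metis mult_zero_right zero_index)
  moreover have "u \<notin> span {v}"
  proof
    assume "u \<in> span {v}"
    then obtain k where "u = k *\<^sub>R v" by (auto simp: span_singleton)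
    then show False using minor by simp
  qed
  ultimately show "independent {u, v}"
    using \<open>u \<noteq> v\<close> by (simp add: independent_insert)
qed

text \<open>
  The first two vectors span the other three, and no two have parallel projections to the
  first two coordinates.
\<close>
lemma sextic_relation_rank:
  defines "R \<equiv> {vector [1, 0, -3, 2], vector [0, 2, -5, 3], vector [3, -4, 1, 0],
               vector [5, -6, 0, 1], vector [1, -2, 2, -1]} :: (real ^ 4) set"
  shows "card R = 5"
    and "S \<subseteq> R \<Longrightarrow> card S = 3 \<Longrightarrow> dependent S"
    and "S \<subseteq> R \<Longrightarrow> card S = 2 \<Longrightarrow> independent S"
proof -
  define a b c d e :: "real ^ 4" where v_defs: "a = vector [1, 0, -3, 2]" "b = vector [0, 2, -5, 3]"
    "c = vector [3, -4, 1, 0]" "d = vector [5, -6, 0, 1]" "e = vector [1, -2, 2, -1]"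
  have R: "R = {a, b, c, d, e}"
    by (simp add: R_def v_defs)
  note minors = independent_pair_of_minor [where i = 1 and j = 2 and 'n = 4]
  have "a \<noteq> b" "a \<noteq> c" "a \<noteq> d" "a \<noteq> e" "b \<noteq> c" "b \<noteq> d" "b \<noteq> e" "c \<noteq> d" "c \<noteq> e" "d \<noteq> e"
    by (rule minors(1); simp add: v_defs vector_4)+
  then show "card R = 5"
    by (simp add: R)
  have pairs: "u $ 1 * v $ 2 \<noteq> u $ 2 * v $ 1" if "u \<in> R" "v \<in> R" "u \<noteq> v" for u v
    using that unfolding R by (auto simp: v_defs vector_4)
  show "independent S" if "S \<subseteq> R" "card S = 2"
  proof -
    obtain u v where "S = {u, v}" "u \<noteq> v" using \<open>card S = 2\<close> by (meson card_2_iff)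
    with \<open>S \<subseteq> R\<close> show ?thesis by (simp add: minors(2) pairs)
  qed
  show "dependent S" if "S \<subseteq> R" and "card S = 3"
  proof (rule ccontr)
    assume "independent S"
    have "c = 3 *\<^sub>R a - 2 *\<^sub>R b" "d = 5 *\<^sub>R a - 3 *\<^sub>R b" "e = a - b"
      by (simp_all add: vec_eq_iff forall_4 v_defs vector_4)
    then have "R \<subseteq> span {a, b}"
      by (simp add: R span_base span_diff span_scale)
    then have "S \<subseteq> span {a, b}" using \<open>S \<subseteq> R\<close> by blast
    then have "card S \<le> card {a, b}"
      using independent_span_bound [OF _ \<open>independent S\<close>, of "{a, b}"] by simp
    also have "\<dots> \<le> 2" by (simp add: card_insert_if)
    finally show False using \<open>card S = 3\<close> by simp
  qed
qed


section \<open>The relations between the means\<close>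

theorem proposition6:
  shows
    "(\<forall>f :: complex poly. degree f = 3 \<longrightarrow>
        phi 3 1 0 f + phi 3 1 2 f = 0) \<and>
     (\<forall>f :: complex poly. degree f = 4 \<longrightarrow>
        phi 4 1 0 f + 2 * phi 4 1 2 f = 0 \<and>
        phi 4 1 0 f + 2 * phi 4 1 3 f = 0 \<and>
        phi 4 1 2 f - phi 4 1 3 f = 0) \<and>
     (\<forall>f :: complex poly. degree f = 5 \<longrightarrow>
        5 * phi 5 1 2 f - 6 * phi 5 1 3 f + phi 5 1 4 f = 0) \<and>
     (\<forall>f :: complex poly. degree f = 6 \<longrightarrow>
        phi 6 1 2 f - 3 * phi 6 1 4 f + 2 * phi 6 1 5 f = 0 \<and>
        2 * phi 6 1 3 f - 5 * phi 6 1 4 f + 3 * phi 6 1 5 f = 0 \<and>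
        3 * phi 6 1 2 f - 4 * phi 6 1 3 f + phi 6 1 4 f = 0 \<and>
        5 * phi 6 1 2 f - 6 * phi 6 1 3 f + phi 6 1 5 f = 0 \<and>
        phi 6 1 2 f - 2 * phi 6 1 3 f + 2 * phi 6 1 4 f - phi 6 1 5 f = 0) \<and>
     (let R = {vector [1, 0, -3, 2], vector [0, 2, -5, 3], vector [3, -4, 1, 0],
               vector [5, -6, 0, 1], vector [1, -2, 2, -1]} :: (real ^ 4) set
      in card R = 5 \<and>
         (\<forall>S \<subseteq> R. card S = 3 \<longrightarrow> dependent S) \<and>
         (\<forall>S \<subseteq> R. card S = 2 \<longrightarrow> independent S))"
proof (intro conjI allI impI)
  fix f :: "complex poly"
  assume "degree f = 3"
  then obtain h where h: "degree h = 3" "coeff h 2 = 0" "\<And>d r. phi 3 d r h = phi 3 d r f"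
    using obtain_depressed_shift [of f 2] by auto
  show "phi 3 1 0 f + phi 3 1 2 f = 0"
    using phi_cubic [OF h(1,2)] by (simp add: h(3))
next
  fix f :: "complex poly"
  assume "degree f = 4"
  then obtain h where h: "degree h = 4" "coeff h 3 = 0" "\<And>d r. phi 4 d r h = phi 4 d r f"
    using obtain_depressed_shift [of f 3] by auto
  show "phi 4 1 0 f + 2 * phi 4 1 2 f = 0" "phi 4 1 0 f + 2 * phi 4 1 3 f = 0"
    "phi 4 1 2 f - phi 4 1 3 f = 0"
    using phi_quartic [OF h(1,2)] by (simp_all add: h(3))
next
  fix f :: "complex poly"
  assume "degree f = 5"
  then obtain h where h: "degree h = 5" "coeff h 4 = 0" "\<And>d r. phi 5 d r h = phi 5 d r f"
    using obtain_depressed_shift [of f 4] by auto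
  show "5 * phi 5 1 2 f - 6 * phi 5 1 3 f + phi 5 1 4 f = 0"
    using phi_quintic [OF h(1,2)] by (simp add: h(3))
next
  fix f :: "complex poly"
  assume "degree f = 6"
  then obtain h where h: "degree h = 6" "coeff h 5 = 0" "\<And>d r. phi 6 d r h = phi 6 d r f"
    using obtain_depressed_shift [of f 5] by auto
  show "phi 6 1 2 f - 3 * phi 6 1 4 f + 2 * phi 6 1 5 f = 0"
    "2 * phi 6 1 3 f - 5 * phi 6 1 4 f + 3 * phi 6 1 5 f = 0"
    "3 * phi 6 1 2 f - 4 * phi 6 1 3 f + phi 6 1 4 f = 0"
    "5 * phi 6 1 2 f - 6 * phi 6 1 3 f + phi 6 1 5 f = 0"
    "phi 6 1 2 f - 2 * phi 6 1 3 f + 2 * phi 6 1 4 f - phi 6 1 5 f = 0"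
    using phi_sextic [OF h(1,2)] by (simp_all add: h(3))
qed (unfold Let_def, intro conjI allI impI sextic_relation_rank; assumption)+

end
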